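(* Let $p$ be an odd prime. Let $\mathcal{T}=\mathcal{L}\times\mathcal{L}$ be the set of ordered pairs of lines of $\mathbb{F}_p^2$. Let $H_p=(h_{\alpha,\beta})_{\alpha,\beta\in\mathcal{T}}$ be the $(p+1)^2\times(p+1)^2$ matrix with $$h_{(L,M),(L',M')}=\begin{cases}1,&\text{if } M=L'\text{ or }M'=L,\\0,&\text{otherwise,}\end{cases}$$ and let $D_p=(d_{\alpha,\beta})_{\alpha,\beta\in\mathcal{T}}$ be the diagonal matrix with $$d_{(L,M),(L',M')}=\begin{cases}1,&\text{if }(L,M)=(L',M')\text{ and }L=M,\\0,&\text{otherwise.}\end{cases}$$ Then the adjacency matrix $A_p=A(G_p)$ is permutation similar to $$H_p\otimes \mathbf{J}_{p-1}-D_p\otimes\mathbf{I}_{p-1}.$$ Equivalently, after ordering the vertices by the type classes $\mathcal{C}_{L,M}$, the block of $A_p$ indexed by $(L,M)$ and $(L',M')$ is $$\begin{cases}\mathbf{J}_{p-1}-\mathbf{I}_{p-1},&\text{if }(L,M)=(L',M')\text{ and }L=M,\\ \mathbf{J}_{p-1},&\text{if }(L,M)\neq(L',M')\text{ and }(M=L'\text{ or }M'=L),\\ \mathbf{O}_{p-1},&\text{otherwise.}\end{cases}$$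
   Context: For $n\ge2$, $\mathbb{L}_n=\{a+bi+cj+dk: a,b,c,d\in\mathbb{Z}/n\mathbb{Z}\}$ is the ring of Lipschitz quaternions modulo $n$, with the usual relations $i^2=j^2=k^2=-1$, $ij=k=-ji$, $jk=i=-kj$, $ki=j=-ik$ taken modulo $n$. A nonzero element $x$ of a ring is a zero divisor if $xy=0$ or $yx=0$ for some nonzero $y$. $G_n=\Gamma(\mathbb{L}_n)$ is the simple undirected graph whose vertices are the nonzero zero divisors of $\mathbb{L}_n$, distinct $x,y$ being adjacent iff $xy=0$ or $yx=0$; $A_n=A(G_n)$ is its adjacency matrix. For an odd prime $p$, $\mathbb{L}_p$ is identified with $M_2(\mathbb{F}_p)$ via a fixed ring isomorphism, so the vertices of $G_p$ are the nonzero singular $2\times2$ matrices over $\mathbb{F}_p$. $\mathcal{L}$ is the set of the $p+1$ one-dimensional subspaces (lines) of $\mathbb{F}_p^2$. For $L,M\in\mathcal{L}$, the type class is $\mathcal{C}_{L,M}=\{A\in M_2(\mathbb{F}_p): A\ne0,\ \det A=0,\ \operatorname{Ker}(A)=L,\ \operatorname{Im}(A)=M\}$; each class has $p-1$ elements and the classes partition the vertex set. $\mathbf{J}_m,\mathbf{I}_m,\mathbf{O}_m$ are the all-ones, identity and zero matrices of order $m$; $\otimes$ is the Kronecker product. *)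

theory Defs
  imports
    "Berlekamp_Zassenhaus.Finite_Field"
    "Jordan_Normal_Form.Matrix_Kernel"
    "Jordan_Normal_Form.DL_Submatrix"
    "HOL-Algebra.QuotRing"
begin

section \<open>Lipschitz quaternions modulo n\<close>

text \<open>\<open>Quat a b c d\<close> stands for $a + bi + cj + dk$. Over the coefficient ring \<open>'n mod_ring\<close>,
  with \<open>n = CARD('n)\<close> and the class \<open>nontriv\<close> expressing \<open>n \<ge> 2\<close>, this is $\mathbb{L}_n$.\<close>

datatype 'a quat = Quat (qre: 'a) (qi: 'a) (qj: 'a) (qk: 'a)

type_synonym 'n lipschitz = "'n mod_ring quat"

instantiation quat :: (comm_ring_1) ring_1
begin

definition zero_quat :: "'a quat" where
  "0 = Quat 0 0 0 0"

definition one_quat :: "'a quat" where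
  "1 = Quat 1 0 0 0"

definition plus_quat :: "'a quat \<Rightarrow> 'a quat \<Rightarrow> 'a quat" where
  "x + y = Quat (qre x + qre y) (qi x + qi y) (qj x + qj y) (qk x + qk y)"

definition uminus_quat :: "'a quat \<Rightarrow> 'a quat" where
  "- x = Quat (- qre x) (- qi x) (- qj x) (- qk x)"

definition minus_quat :: "'a quat \<Rightarrow> 'a quat \<Rightarrow> 'a quat" where
  "x - y = Quat (qre x - qre y) (qi x - qi y) (qj x - qj y) (qk x - qk y)"

definition times_quat :: "'a quat \<Rightarrow> 'a quat \<Rightarrow> 'a quat" where
  "x * y = Quat
     (qre x * qre y - qi x * qi y - qj x * qj y - qk x * qk y)
     (qre x * qi y + qi x * qre y + qj x * qk y - qk x * qj y)
     (qre x * qj y - qi x * qk y + qj x * qre y + qk x * qi y)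
     (qre x * qk y + qi x * qj y - qj x * qi y + qk x * qre y)"

lemmas quat_defs =
  zero_quat_def one_quat_def plus_quat_def uminus_quat_def minus_quat_def times_quat_def

instance
  by standard (auto simp: quat_defs algebra_simps)

end

lemma quat_relations:
  fixes i j k :: "'a::comm_ring_1 quat"
  defines "i \<equiv> Quat 0 1 0 0" and "j \<equiv> Quat 0 0 1 0" and "k \<equiv> Quat 0 0 0 1"
  shows "i * i = - 1" "j * j = - 1" "k * k = - 1"
    "i * j = k" "j * i = - k" "j * k = i" "k * j = - i" "k * i = j" "i * k = - j"
  by (auto simp: i_def j_def k_def quat_defs)


section \<open>Zero divisor graphs and adjacency matrices\<close>

definition zero_divisors :: "'a::ring set" where
  "zero_divisors = {x. x \<noteq> 0 \<and> (\<exists>y. y \<noteq> 0 \<and> (x * y = 0 \<or> y * x = 0))}"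

text \<open>Simple undirected graphs are pairs of a vertex set and a set of two-element edges.\<close>

type_synonym 'v sgraph = "'v set \<times> 'v set set"

definition zero_divisor_graph :: "'a::ring sgraph" where
  "zero_divisor_graph =
     (zero_divisors,
      {{x, y} | x y. x \<in> zero_divisors \<and> y \<in> zero_divisors \<and> x \<noteq> y \<and> (x * y = 0 \<or> y * x = 0)})"

definition lipschitz_graph :: "'n::nontriv lipschitz sgraph" where
  "lipschitz_graph = zero_divisor_graph"

definition enumerates :: "'a list \<Rightarrow> 'a set \<Rightarrow> bool" where
  "enumerates xs S \<longleftrightarrow> distinct xs \<and> set xs = S"

text \<open>A matrix with rows and columns indexed by a finite set becomes a \<open>mat\<close>
  once an enumeration \<open>xs\<close> of that index set is chosen.\<close>

definition indexed_mat :: "'a list \<Rightarrow> ('a \<Rightarrow> 'a \<Rightarrow> 'b) \<Rightarrow> 'b mat" where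
  "indexed_mat xs f = mat (length xs) (length xs) (\<lambda>(i, j). f (xs ! i) (xs ! j))"

definition adjacency_matrix :: "'v sgraph \<Rightarrow> 'v list \<Rightarrow> int mat" where
  "adjacency_matrix G vs = indexed_mat vs (\<lambda>x y. if {x, y} \<in> snd G then 1 else 0)"


section \<open>Matrix operations\<close>

definition ones_mat :: "nat \<Rightarrow> 'a::one mat" where
  "ones_mat m = mat m m (\<lambda>_. 1)"

definition kronecker :: "'a::times mat \<Rightarrow> 'a mat \<Rightarrow> 'a mat" where
  "kronecker A B = mat (dim_row A * dim_row B) (dim_col A * dim_col B)
     (\<lambda>(i, j). A $$ (i div dim_row B, j div dim_col B) * B $$ (i mod dim_row B, j mod dim_col B))"

definition permutation_matrix :: "nat \<Rightarrow> 'a::{zero,one} mat \<Rightarrow> bool" where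
  "permutation_matrix n P \<longleftrightarrow>
     (\<exists>\<pi>. \<pi> permutes {..<n} \<and> P = mat n n (\<lambda>(i, j). if j = \<pi> i then 1 else 0))"

definition permutation_similar :: "'a::semiring_1 mat \<Rightarrow> 'a mat \<Rightarrow> bool" where
  "permutation_similar A B \<longleftrightarrow>
     (\<exists>P. permutation_matrix (dim_row A) P \<and> similar_mat_wit A B P P\<^sup>T)"

text \<open>The \<open>(a, b)\<close> block of a matrix partitioned into \<open>m\<close> by \<open>m\<close> blocks, counted from 0.\<close>

definition mat_block :: "nat \<Rightarrow> 'a mat \<Rightarrow> nat \<Rightarrow> nat \<Rightarrow> 'a mat" where
  "mat_block m A a b = submatrix A {a * m..<(a + 1) * m} {b * m..<(b + 1) * m}"


section \<open>Lines, type classes, and the matrices H and D\<close>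

definition lines :: "'a::field vec set set" where
  "lines = {L. VectorSpace.subspace class_ring L (module_vec TYPE('a) 2) \<and>
               vectorspace.dim class_ring ((module_vec TYPE('a) 2)\<lparr>carrier := L\<rparr>) = 1}"

definition line_pairs :: "('a::field vec set \<times> 'a vec set) set" where
  "line_pairs = lines \<times> lines"

definition mat_image :: "'a::semiring_0 mat \<Rightarrow> 'a vec set" where
  "mat_image A = (\<lambda>v. A *\<^sub>v v) ` carrier_vec (dim_col A)"

text \<open>The type class $\mathcal{C}_{L,M}$ of nonzero singular matrices.\<close>

definition ker_im_class :: "'a::field vec set \<times> 'a vec set \<Rightarrow> 'a mat set" where
  "ker_im_class = (\<lambda>(L, M).
     {A \<in> carrier_mat 2 2. A \<noteq> 0\<^sub>m 2 2 \<and> det A = 0 \<and> mat_kernel A = L \<and> mat_image A = M})"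

definition H_mat :: "('a::field vec set \<times> 'a vec set) list \<Rightarrow> int mat" where
  "H_mat ts = indexed_mat ts (\<lambda>(L, M) (L', M'). if M = L' \<or> M' = L then 1 else 0)"

definition D_mat :: "('a::field vec set \<times> 'a vec set) list \<Rightarrow> int mat" where
  "D_mat ts = indexed_mat ts (\<lambda>(L, M) (L', M'). if (L, M) = (L', M') \<and> L = M then 1 else 0)"


section \<open>Lipschitz quaternions modulo an odd prime are matrices\<close>

abbreviation quat_mat_isos :: "('p::prime_card lipschitz \<Rightarrow> 'p mod_ring mat) set" where
  "quat_mat_isos \<equiv> ring_iso class_ring (ring_mat TYPE('p mod_ring) 2 ())"

lemma minus_one_sum_two_squares:
  assumes "odd CARD('p::prime_card)"
  shows "\<exists>u v :: 'p mod_ring. u * u + v * v = - 1"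
proof (rule ccontr)
  assume none: "\<not> ?thesis"
  let ?S = "range (\<lambda>x :: 'p mod_ring. x * x)"
  let ?T = "(\<lambda>y. - 1 - y) ` ?S"
  have "?S \<inter> ?T = {}"
  proof (rule ccontr)
    assume "?S \<inter> ?T \<noteq> {}"
    then obtain u v :: "'p mod_ring" where "u * u = - 1 - v * v" by auto
    hence "u * u + v * v = - 1" by (simp add: algebra_simps)
    thus False using none by blast
  qed
  hence "card (?S \<union> ?T) = card ?S + card ?T" by (intro card_Un_disjoint) auto
  moreover have "card ?T = card ?S" by (intro card_image) (auto simp: inj_on_def)
  moreover have "card (?S \<union> ?T) \<le> CARD('p mod_ring)" by (intro card_mono) auto
  ultimately have le: "2 * card ?S \<le> CARD('p)" by simp
  have "(UNIV :: 'p mod_ring set) = (\<Union>s \<in> ?S. {x. x * x = s})" by auto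
  hence "CARD('p mod_ring) = card (\<Union>s \<in> ?S. {x :: 'p mod_ring. x * x = s})" by simp
  also have "\<dots> \<le> (\<Sum>s \<in> ?S. card {x :: 'p mod_ring. x * x = s})" by (intro card_UN_le) auto
  also have "\<dots> \<le> (\<Sum>s \<in> ?S. 2)"
  proof (intro sum_mono)
    fix s :: "'p mod_ring" assume "s \<in> ?S"
    then obtain r where r: "s = r * r" by auto
    have "{x. x * x = s} \<subseteq> {r, - r}" using r by (auto simp: square_eq_iff)
    hence "card {x. x * x = s} \<le> card {r, - r}" by (intro card_mono) auto
    also have "\<dots> \<le> 2" by (simp add: card_insert_if)
    finally show "card {x. x * x = s} \<le> 2" .
  qed
  finally have "CARD('p) \<le> 2 * card ?S" by simp
  with le have "CARD('p) = 2 * card ?S" by simp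
  thus False using assms by simp
qed

lemma two_neq_zero:
  assumes "odd CARD('p::prime_card)"
  shows "(2 :: 'p mod_ring) \<noteq> 0"
proof
  assume "(2 :: 'p mod_ring) = 0"
  hence "(of_nat 2 :: 'p mod_ring) = 0" by simp
  hence "of_int_mod_ring (int 2) = (0 :: 'p mod_ring)"
    by (metis of_nat_of_int_mod_ring comp_apply)
  hence "CARD('p) dvd 2"
    by transfer (metis dvd_eq_mod_eq_0 int_dvd_int_iff)
  hence "CARD('p) \<le> 2" by (auto dest: dvd_imp_le)
  moreover have "CARD('p) > 1" by (rule nontriv)
  ultimately have "CARD('p) = 2" by simp
  thus False using assms by simp
qed

text \<open>Statements about every isomorphism in \<open>quat_mat_isos\<close> are therefore not vacuous.\<close>

lemma quat_mat_isos_nonempty: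
  assumes odd: "odd CARD('p::prime_card)"
  shows "(quat_mat_isos :: ('p lipschitz \<Rightarrow> 'p mod_ring mat) set) \<noteq> {}"
proof -
  obtain u v :: "'p mod_ring" where uv: "u * u + v * v = - 1"
    using minus_one_sum_two_squares[OF odd] by blast
  note two = two_neq_zero[OF odd]
  define M :: "'p mod_ring \<Rightarrow> 'p mod_ring \<Rightarrow> 'p mod_ring \<Rightarrow> 'p mod_ring \<Rightarrow> 'p mod_ring mat"
    where "M a b c d = mat 2 2 (\<lambda>(i, j). if i = 0 then (if j = 0 then a else b)
                                       else (if j = 0 then c else d))" for a b c d
  have M_carrier: "M a b c d \<in> carrier_mat 2 2" for a b c d by (simp add: M_def)
  have M_eqI: "A = M (A $$ (0,0)) (A $$ (0,1)) (A $$ (1,0)) (A $$ (1,1))"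
    if "A \<in> carrier_mat 2 2" for A
    using that by (intro eq_matI) (auto simp: M_def less_2_cases_iff)
  have M_inj: "M a b c d = M a' b' c' d' \<longleftrightarrow> a = a' \<and> b = b' \<and> c = c' \<and> d = d'"
    for a b c d a' b' c' d'
  proof
    assume eq: "M a b c d = M a' b' c' d'"
    have "M a b c d $$ (0,0) = a" "M a b c d $$ (0,1) = b"
      "M a b c d $$ (1,0) = c" "M a b c d $$ (1,1) = d" for a b c d by (auto simp: M_def)
    with eq show "a = a' \<and> b = b' \<and> c = c' \<and> d = d'" by metis
  qed auto
  have M_add: "M a b c d + M a' b' c' d' = M (a + a') (b + b') (c + c') (d + d')"
    for a b c d a' b' c' d'
    by (intro eq_matI) (auto simp: M_def)
  have M_mult: "M a b c d * M a' b' c' d' =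
      M (a * a' + b * c') (a * b' + b * d') (c * a' + d * c') (c * b' + d * d')"
    for a b c d a' b' c' d'
  proof -
    have "{0..<2} = {0, 1 :: nat}" by auto
    thus ?thesis by (intro eq_matI) (auto simp: M_def scalar_prod_def)
  qed
  have M_one: "1\<^sub>m 2 = M 1 0 0 1"
    by (intro eq_matI) (auto simp: M_def)
  define h :: "'p lipschitz \<Rightarrow> 'p mod_ring mat" where
    "h x = M (qre x + u * qj x - v * qk x) (- qi x + v * qj x + u * qk x)
             (qi x + v * qj x + u * qk x) (qre x - u * qj x + v * qk x)" for x
  have uu: "u * u = - 1 - v * v" using uv by (simp add: algebra_simps)
  have uu': "u * (u * z) = - z - v * (v * z)" for z
    using arg_cong[OF uu, of "\<lambda>w. w * z"] by (simp add: algebra_simps)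
  have uu'': "z * (u * u) = - z - z * (v * v)" for z
    by (simp add: uu algebra_simps)
  have "h \<in> Ring.ring_hom class_ring (ring_mat TYPE('p mod_ring) 2 ())"
  proof (rule ring_hom_memI)
    fix x y :: "'p lipschitz"
    show "h x \<in> carrier (ring_mat TYPE('p mod_ring) 2 ())"
      by (simp add: h_def M_carrier ring_mat_simps)
    show "h (x \<otimes>\<^bsub>class_ring\<^esub> y) = h x \<otimes>\<^bsub>ring_mat TYPE('p mod_ring) 2 ()\<^esub> h y"
      by (simp add: h_def M_mult M_inj times_quat_def ring_mat_simps)
        (simp add: algebra_simps uu uu' uu'')
    show "h (x \<oplus>\<^bsub>class_ring\<^esub> y) = h x \<oplus>\<^bsub>ring_mat TYPE('p mod_ring) 2 ()\<^esub> h y"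
      by (simp add: h_def M_add M_inj plus_quat_def ring_mat_simps algebra_simps)
    show "h \<one>\<^bsub>class_ring\<^esub> = \<one>\<^bsub>ring_mat TYPE('p mod_ring) 2 ()\<^esub>"
      by (simp add: h_def M_one M_inj one_quat_def ring_mat_simps)
  qed
  moreover have "bij_betw h UNIV (carrier_mat 2 2)"
  proof (intro bij_betw_imageI subset_antisym subsetI)
    define w where "w = inverse (2 :: 'p mod_ring)"
    have ww: "w + w = 1" using two by (simp add: w_def flip: mult_2)
    show "inj h"
    proof (rule injI)
      fix x y assume "h x = h y"
      define a b c d where "a = qre x - qre y" and "b = qi x - qi y"
        and "c = qj x - qj y" and "d = qk x - qk y"
      have e: "a + u * c - v * d = 0" "- b + v * c + u * d = 0"
          "b + v * c + u * d = 0" "a - u * c + v * d = 0"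
        using \<open>h x = h y\<close> by (auto simp: h_def M_inj a_def b_def c_def d_def algebra_simps)
      have "2 * a = (a + u * c - v * d) + (a - u * c + v * d)" by simp
      hence a: "a = 0" unfolding e using two by simp
      have "2 * b = (b + v * c + u * d) - (- b + v * c + u * d)" by simp
      hence b: "b = 0" unfolding e using two by simp
      have 1: "u * c - v * d = 0" "v * c + u * d = 0" using e(1,2) unfolding a b by auto
      have "- c = u * (u * c - v * d) + v * (v * c + u * d)"
        by (simp add: algebra_simps uu' uu'')
      hence c: "c = 0" using 1 by simp
      have "- d = u * (v * c + u * d) - v * (u * c - v * d)"
        by (simp add: algebra_simps uu' uu'')
      hence d: "d = 0" using 1 by simp
      show "x = y" using a b c d by (auto simp: a_def b_def c_def d_def intro: quat.expand)
    qed
    fix A :: "'p mod_ring mat"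
    show "A \<in> carrier_mat 2 2" if "A \<in> range h" using that by (auto simp: h_def M_carrier)
    show "A \<in> range h" if A: "A \<in> carrier_mat 2 2"
    proof -
      obtain a b c d where Aeq: "A = M a b c d" using M_eqI[OF A] by blast
      define s t where "s = w * (a - d)" and "t = w * (b + c)"
      have half: "w * z + w * z = z" for z
        using ww by (metis distrib_right mult_1)
      have "h (Quat (w * (a + d)) (w * (c - b)) (- u * s - v * t) (v * s - u * t)) = A"
      proof -
        have 1: "u * (- u * s - v * t) - v * (v * s - u * t) = s"
          by (simp add: algebra_simps uu' uu'')
        have 2: "v * (- u * s - v * t) + u * (v * s - u * t) = t"
          by (simp add: algebra_simps uu' uu'')
        have "w * (a + d) + s = a" "w * (a + d) - s = d"
          "- (w * (c - b)) + t = b" "w * (c - b) + t = c"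
          using half[of a] half[of b] half[of c] half[of d]
          by (simp_all add: s_def t_def algebra_simps)
        then show ?thesis using 1 2 unfolding h_def Aeq M_inj
          by (simp add: algebra_simps)
      qed
      thus ?thesis by blast
    qed
  qed
  ultimately have "h \<in> quat_mat_isos" by (simp add: ring_iso_def ring_mat_simps)
  thus ?thesis by blast
qed

end

theory Submission
  imports Defs
begin

text \<open>
  A nonzero singular $2 \times 2$ matrix has rank one, hence is the map
  $x \mapsto (v \wedge x)\,w$ for nonzero vectors $v$ and $w$, where $\wedge$ is the determinant of
  two vectors; its kernel is the line through $v$ and its image the line through $w$
  (\<open>singular_eq_rank_one\<close>, \<open>mat_kernel_rank_one\<close>, \<open>mat_image_rank_one\<close>). Fixing both lines fixes
  the matrix up to a nonzero scalar, so each type class has $p - 1$ elements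
  (\<open>card_ker_im_class\<close>). Moreover $AB = 0$ says that the image of $B$ lies in the kernel of $A$, and
  as both are lines it says that they coincide (\<open>ker_im_class_mult_eq_0_iff\<close>).

  Through an isomorphism with the matrix ring, the zero divisors among the quaternions
  are thus partitioned into the classes $\mathcal{C}_{L,M}$, and two distinct vertices of types
  $(L,M)$ and $(L',M')$ are adjacent exactly if $M = L'$ or $M' = L$ (\<open>edge_iff\<close>). This depends on
  the types alone and is the entry of $H_p$. The one exception to blockwise constancy is that a
  vertex is not adjacent to itself: the condition holds for a type paired with itself iff
  $L = M$, and in these blocks the diagonal has to be removed, which is what
  $D_p \otimes \mathbf{I}$ does. So for vertices listed class by class the adjacency matrix equals
  $H_p \otimes \mathbf{J} - D_p \otimes \mathbf{I}$ (\<open>adjacency_matrix_eq_kronecker\<close>), and any other list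
  of the vertices is a permutation of such a list (\<open>permutation_similar_indexed_mat\<close>).
\<close>

section \<open>Vectors and matrices of size two\<close>

definition vec2 :: "'a \<Rightarrow> 'a \<Rightarrow> 'a vec" where
  "vec2 a b = vec 2 (\<lambda>i. if i = 0 then a else b)"

definition mat2 :: "'a \<Rightarrow> 'a \<Rightarrow> 'a \<Rightarrow> 'a \<Rightarrow> 'a mat" where
  "mat2 a b c d = mat 2 2 (\<lambda>(i, j). if i = 0 then if j = 0 then a else b
                                      else if j = 0 then c else d)"

lemma vec2_carrier [simp]: "vec2 a b \<in> carrier_vec 2"
  by (simp add: vec2_def)

lemma vec2_index [simp]: "vec2 a b $ 0 = a" "vec2 a b $ 1 = b" "vec2 a b $ Suc 0 = b"
  by (auto simp: vec2_def)

lemma vec2_eq_iff [simp]: "vec2 a b = vec2 c d \<longleftrightarrow> a = c \<and> b = d"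
  by (metis vec2_index(1,2))

lemma vec2_cases:
  assumes "v \<in> carrier_vec 2"
  obtains a b where "v = vec2 a b"
proof
  show "v = vec2 (v $ 0) (v $ 1)"
    using assms by (intro eq_vecI) (auto simp: vec2_def less_2_cases_iff)
qed

lemma zero_vec2: "0\<^sub>v 2 = vec2 0 0"
  by (intro eq_vecI) (auto simp: vec2_def)

lemma smult_vec2 [simp]: "c \<cdot>\<^sub>v vec2 a b = vec2 (c * a) (c * b)"
  by (intro eq_vecI) (auto simp: vec2_def)

lemma mat2_carrier [simp]: "mat2 a b c d \<in> carrier_mat 2 2"
  by (simp add: mat2_def)

lemma mat2_dim [simp]: "dim_row (mat2 a b c d) = 2" "dim_col (mat2 a b c d) = 2"
  by (simp_all add: mat2_def)

lemma mat2_index [simp]: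
  "mat2 a b c d $$ (0, 0) = a" "mat2 a b c d $$ (0, 1) = b"
  "mat2 a b c d $$ (1, 0) = c" "mat2 a b c d $$ (1, 1) = d"
  by (auto simp: mat2_def)

lemma mat2_eq_iff [simp]:
  "mat2 a b c d = mat2 a' b' c' d' \<longleftrightarrow> a = a' \<and> b = b' \<and> c = c' \<and> d = d'"
  by (metis mat2_index)

lemma mat2_cases:
  assumes "A \<in> carrier_mat 2 2"
  obtains a b c d where "A = mat2 a b c d"
proof
  show "A = mat2 (A $$ (0, 0)) (A $$ (0, 1)) (A $$ (1, 0)) (A $$ (1, 1))"
    using assms by (intro eq_matI) (auto simp: mat2_def less_2_cases_iff)
qed

lemma zero_mat2: "0\<^sub>m 2 2 = mat2 0 0 0 0"
  by (intro eq_matI) (auto simp: mat2_def)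

lemma add_mat2: "mat2 a b c d + mat2 a' b' c' d' = mat2 (a + a') (b + b') (c + c') (d + d')"
  by (intro eq_matI) (auto simp: mat2_def)

lemma mat2_mult_vec2 [simp]:
  "mat2 a b c d *\<^sub>v vec2 x y = vec2 (a * x + b * y) (c * x + d * y)"
proof -
  have "{0..<2} = {0, 1 :: nat}" by auto
  thus ?thesis by (intro eq_vecI) (auto simp: mat2_def vec2_def scalar_prod_def)
qed

lemma mat2_mult [simp]:
  "mat2 a b c d * mat2 a' b' c' d' =
   mat2 (a * a' + b * c') (a * b' + b * d') (c * a' + d * c') (c * b' + d * d')"
proof -
  have "{0..<2} = {0, 1 :: nat}" by auto
  thus ?thesis by (intro eq_matI) (auto simp: mat2_def scalar_prod_def)
qed

lemma det_mat2 [simp]: "det (mat2 a b c d) = a * d - b * c"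
  for a b c d :: "'a::comm_ring_1"
proof -
  have "det (mat2 a b c d) = (\<Sum>j<2. mat2 a b c d $$ (0, j) * cofactor (mat2 a b c d) 0 j)"
    by (rule laplace_expansion_row) auto
  also have "\<dots> = a * d - b * c"
    by (simp add: numeral_2_eq_2 cofactor_def mat_delete_def det_single mat2_def)
  finally show ?thesis .
qed

text \<open>The determinant of the matrix with columns $v$ and $x$. For fixed $v \neq 0$ it is a linear form
  whose kernel is the line through $v$; this makes collinearity an equation.\<close>

definition wedge :: "'a::comm_ring_1 vec \<Rightarrow> 'a vec \<Rightarrow> 'a" where
  "wedge v x = v $ 0 * x $ 1 - v $ 1 * x $ 0"

lemma wedge_vec2 [simp]: "wedge (vec2 a b) (vec2 c d) = a * d - b * c"
  by (simp add: wedge_def)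


section \<open>Lines in the plane over a finite field\<close>

definition line_through :: "'a::field vec \<Rightarrow> 'a vec set" where
  "line_through v = range (\<lambda>c. c \<cdot>\<^sub>v v)"

abbreviation nonzero_vecs :: "'a::field vec set" where
  "nonzero_vecs \<equiv> carrier_vec 2 - {0\<^sub>v 2}"

lemma self_in_line_through: "v \<in> line_through v"
  unfolding line_through_def by (rule range_eqI[of _ _ 1]) auto

lemma line_through_eq_wedge:
  fixes v :: "'a::field vec"
  assumes v: "v \<in> nonzero_vecs"
  shows "line_through v = {x \<in> carrier_vec 2. wedge v x = 0}"
proof -
  from v obtain a b where ab: "v = vec2 a b" "a \<noteq> 0 \<or> b \<noteq> 0"
    by (auto simp: zero_vec2 elim!: vec2_cases)
  show ?thesis
  proof (intro subset_antisym subsetI)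
    fix x assume "x \<in> line_through v"
    thus "x \<in> {x \<in> carrier_vec 2. wedge v x = 0}" by (auto simp: line_through_def ab)
  next
    fix x assume "x \<in> {x \<in> carrier_vec 2. wedge v x = 0}"
    then obtain c d where x: "x = vec2 c d" "a * d = b * c"
      by (auto simp: ab elim!: vec2_cases)
    \<comment> \<open>The factor is read off from a coordinate in which v does not vanish.\<close>
    have "x = (if a = 0 then d / b else c / a) \<cdot>\<^sub>v v"
      using ab x by (auto simp: field_simps)
    thus "x \<in> line_through v" unfolding line_through_def by blast
  qed
qed

lemma line_through_cong:
  fixes v w :: "'a::field vec"
  assumes v: "v \<in> nonzero_vecs" and w: "w \<in> nonzero_vecs" and "w \<in> line_through v"
  shows "line_through w = line_through v"
proof -
  obtain c where c: "w = c \<cdot>\<^sub>v v" using assms(3) by (auto simp: line_through_def)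
  have "c \<noteq> 0" using c v w by auto
  show ?thesis unfolding line_through_def
  proof (intro subset_antisym subsetI; elim rangeE; hypsubst)
    fix d
    show "d \<cdot>\<^sub>v w \<in> range (\<lambda>c. c \<cdot>\<^sub>v v)"
      using c by (auto simp: smult_smult_assoc)
    have "d \<cdot>\<^sub>v v = (d / c) \<cdot>\<^sub>v w"
      using c \<open>c \<noteq> 0\<close> by (simp add: smult_smult_assoc)
    thus "d \<cdot>\<^sub>v v \<in> range (\<lambda>c. c \<cdot>\<^sub>v w)" by blast
  qed
qed

lemma line_through_eq_iff:
  fixes v w :: "'a::field vec"
  assumes "v \<in> nonzero_vecs" "w \<in> nonzero_vecs"
  shows "line_through v = line_through w \<longleftrightarrow> wedge v w = 0"
  using line_through_cong[OF assms] line_through_eq_wedge[OF assms(1)]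
    self_in_line_through[of w] assms by auto

lemma (in vec_space) span_singleton:
  assumes "v \<in> carrier_vec n"
  shows "span {v} = range (\<lambda>c. c \<cdot>\<^sub>v v)"
proof (intro subset_antisym subsetI)
  fix x assume "x \<in> span {v}"
  then obtain a where "x = lincomb a {v}"
    using finite_in_span[of "{v}" x] assms by auto
  thus "x \<in> range (\<lambda>c. c \<cdot>\<^sub>v v)" using assms by (auto simp: lincomb_def)
next
  fix x assume "x \<in> range (\<lambda>c. c \<cdot>\<^sub>v v)"
  then obtain c where "x = c \<cdot>\<^sub>v v" by auto
  hence "x = lincomb (\<lambda>_. c) {v}" using assms by (simp add: lincomb_def)
  thus "x \<in> span {v}" unfolding span_def by blast
qed

lemma (in vec_space) lin_dep_singleton:
  assumes "v \<in> carrier_vec n"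
  shows "lin_dep {v} \<longleftrightarrow> v = 0\<^sub>v n"
proof -
  have "span {} = {0\<^sub>v n}" by (auto simp: span_def)
  thus ?thesis using assms lindep_span[of "{v}"] by auto
qed

text \<open>This trades the dimension of a subspace, defined by cardinalities of generating sets within
  that subspace, for an explicit generator. Finiteness of the field serves to see at once that a
  subspace is finite-dimensional, so that it has a basis.\<close>

lemma lines_eq_line_through:
  "(lines :: 'a::{field,finite} vec set set) = line_through ` nonzero_vecs"
proof (intro subset_antisym subsetI)
  interpret V: vec_space "TYPE('a)" 2 .
  {
    fix L :: "'a vec set" assume "L \<in> lines"
    hence sub: "VectorSpace.subspace class_ring L V.V"
      and dim: "vectorspace.dim class_ring (V.vs L) = 1" by (auto simp: lines_def)
    interpret L: vectorspace class_ring "V.vs L" by (rule V.subspace_is_vs[OF sub])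
    have subm: "submodule class_ring L V.V" using sub by simp
    have Lc: "L \<subseteq> carrier_vec 2" using submodule.subset[OF subm] by simp
    have "finite (carrier_vec 2 :: 'a vec set)"
    proof (rule finite_surj)
      show "carrier_vec 2 \<subseteq> (\<lambda>(a, b). vec2 a b) ` (UNIV :: ('a \<times> 'a) set)"
        by (auto elim!: vec2_cases)
    qed simp
    hence "finite L" using Lc finite_subset by blast
    hence "L.fin_dim" unfolding L.fin_dim_def
      using L.in_own_span[of L] L.span_is_subset2[of L] by auto
    then obtain B where B: "finite B" "L.basis B" using L.finite_basis_exists by blast
    hence "card B = 1" using L.dim_basis dim by simp
    then obtain v where v: "B = {v}" by (auto simp: card_1_singleton_iff)
    have vL: "{v} \<subseteq> L" using B v by (auto simp: L.basis_def)
    hence vc: "v \<in> carrier_vec 2" using Lc by auto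
    have "L.span {v} = L" using B v by (simp add: L.basis_def)
    hence "L = line_through v"
      using V.span_li_not_depend(1)[OF vL subm] V.span_singleton[OF vc]
      by (simp add: line_through_def)
    moreover have "\<not> V.lin_dep {v}"
      using B v V.span_li_not_depend(2)[OF vL subm] by (simp add: L.basis_def)
    ultimately show "L \<in> line_through ` nonzero_vecs"
      using V.lin_dep_singleton[OF vc] vc by auto
  }
  {
    fix L :: "'a vec set" assume "L \<in> line_through ` nonzero_vecs"
    then obtain v where v: "v \<in> carrier_vec 2" "v \<noteq> 0\<^sub>v 2" and L: "L = line_through v" by auto
    have span: "V.span {v} = L" using V.span_singleton[OF v(1)] L by (simp add: line_through_def)
    have sub: "VectorSpace.subspace class_ring L V.V"
      using V.span_is_subspace[of "{v}"] v span by simp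
    have subm: "submodule class_ring L V.V" using sub by simp
    interpret L: vectorspace class_ring "V.vs L" by (rule V.subspace_is_vs[OF sub])
    have vL: "{v} \<subseteq> L" using L self_in_line_through by auto
    have "L.basis {v}"
      using V.span_li_not_depend[OF vL subm] span V.lin_dep_singleton[OF v(1)] v vL
      by (simp add: L.basis_def)
    hence "L.dim = 1" using L.dim_basis[of "{v}"] by simp
    thus "L \<in> lines" using sub by (simp add: lines_def)
  }
qed

lemma line_obtain:
  fixes L :: "'a::{field,finite} vec set"
  assumes "L \<in> lines"
  obtains v where "v \<in> nonzero_vecs" "L = line_through v"
  using assms by (auto simp: lines_eq_line_through)

text \<open>A line is given by its slope $t$, being the line through $(1, t)$, or it is vertical.\<close>

lemma card_lines:
  "card (lines :: 'a::{field,finite} vec set set) = CARD('a) + 1"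
proof -
  let ?f = "\<lambda>t :: 'a. line_through (vec2 1 t)"
  let ?inf = "line_through (vec2 0 1) :: 'a vec set"
  have lines: "lines = insert ?inf (range ?f)"
  proof (intro subset_antisym subsetI)
    fix L :: "'a vec set" assume "L \<in> lines"
    then obtain v where v: "v \<in> nonzero_vecs" "L = line_through v" by (rule line_obtain)
    then obtain a b where ab: "v = vec2 a b" "a \<noteq> 0 \<or> b \<noteq> 0"
      by (auto simp: zero_vec2 elim!: vec2_cases)
    show "L \<in> insert ?inf (range ?f)"
    proof (cases "a = 0")
      case True
      thus ?thesis using v ab by (simp add: line_through_eq_iff zero_vec2)
    next
      case False
      hence "L = ?f (b / a)" using v ab by (simp add: line_through_eq_iff zero_vec2)
      thus ?thesis by blast
    qed
  qed (auto simp: lines_eq_line_through zero_vec2)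
  have "?inf \<notin> range ?f"
    by (auto simp: line_through_eq_iff zero_vec2)
  hence "card (lines :: 'a vec set set) = Suc (card (range ?f))"
    unfolding lines by (rule card_insert_disjoint[OF finite_imageI[OF finite]])
  moreover have "inj ?f"
    by (auto simp: inj_def line_through_eq_iff zero_vec2)
  ultimately show ?thesis by (simp add: card_image)
qed

section \<open>Singular matrices are determined by kernel, image and a scalar\<close>

text \<open>The matrix of $x \mapsto (v \wedge x)\, w$.\<close>

definition rank_one :: "'a::comm_ring_1 vec \<Rightarrow> 'a vec \<Rightarrow> 'a mat" where
  "rank_one v w = mat2 (- (w $ 0 * v $ 1)) (w $ 0 * v $ 0) (- (w $ 1 * v $ 1)) (w $ 1 * v $ 0)"

lemma rank_one_carrier [simp]: "rank_one v w \<in> carrier_mat 2 2"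
  by (simp add: rank_one_def)

lemma rank_one_dim [simp]: "dim_row (rank_one v w) = 2" "dim_col (rank_one v w) = 2"
  by (simp_all add: rank_one_def)

lemma rank_one_mult_vec:
  assumes "v \<in> carrier_vec 2" "w \<in> carrier_vec 2" "x \<in> carrier_vec 2"
  shows "rank_one v w *\<^sub>v x = wedge v x \<cdot>\<^sub>v w"
  using assms by (auto simp: rank_one_def algebra_simps elim!: vec2_cases)

lemma rank_one_nonzero:
  fixes v w :: "'a::field vec"
  assumes "v \<in> nonzero_vecs" "w \<in> nonzero_vecs"
  shows "rank_one v w \<noteq> 0\<^sub>m 2 2"
  using assms by (auto simp: rank_one_def zero_mat2 zero_vec2 elim!: vec2_cases)

lemma det_rank_one: "det (rank_one v w) = 0"
  by (simp add: rank_one_def)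

lemma singular_eq_rank_one:
  fixes A :: "'a::field mat"
  assumes "A \<in> carrier_mat 2 2" "A \<noteq> 0\<^sub>m 2 2" "det A = 0"
  obtains v w where "v \<in> nonzero_vecs" "w \<in> nonzero_vecs" "A = rank_one v w"
proof -
  from assms obtain a b c d where A: "A = mat2 a b c d" and ad: "a * d = b * c"
    and nz: "a \<noteq> 0 \<or> b \<noteq> 0 \<or> c \<noteq> 0 \<or> d \<noteq> 0"
    by (auto simp: zero_mat2 elim!: mat2_cases)
  \<comment> \<open>If the first row is nonzero, the second row is a multiple of it, and the image is spanned by
    $(1, \lambda)$ with that factor $\lambda$; otherwise by $(0, 1)$. The kernel is orthogonal to a
    nonzero row.\<close>
  show ?thesis
  proof (cases "a = 0 \<and> b = 0")
    case True
    with nz show ?thesis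
      by (intro that[of "vec2 d (- c)" "vec2 0 1"]) (auto simp: A rank_one_def zero_vec2)
  next
    case False
    thus ?thesis
      by (intro that[of "vec2 b (- a)" "vec2 1 (if a = 0 then d / b else c / a)"])
        (use ad in \<open>auto simp: A rank_one_def zero_vec2 field_simps\<close>)
  qed
qed

lemma mat_kernel_rank_one:
  fixes v w :: "'a::field vec"
  assumes "v \<in> nonzero_vecs" "w \<in> nonzero_vecs"
  shows "mat_kernel (rank_one v w) = line_through v"
proof -
  have "rank_one v w *\<^sub>v x = 0\<^sub>v 2 \<longleftrightarrow> wedge v x = 0" if "x \<in> carrier_vec 2" for x
    using that assms by (auto simp: rank_one_mult_vec zero_vec2 elim!: vec2_cases)
  thus ?thesis unfolding line_through_eq_wedge[OF assms(1)]
    by (auto simp: mat_kernel_def rank_one_def)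
qed

lemma mat_image_rank_one:
  fixes v w :: "'a::field vec"
  assumes v: "v \<in> nonzero_vecs" and w: "w \<in> nonzero_vecs"
  shows "mat_image (rank_one v w) = line_through w"
proof -
  have "\<exists>x \<in> carrier_vec 2. wedge v x = c" for c
  proof -
    from v obtain a b where ab: "v = vec2 a b" "a \<noteq> 0 \<or> b \<noteq> 0"
      by (auto simp: zero_vec2 elim!: vec2_cases)
    have "wedge v (if a = 0 then vec2 (- c / b) 0 else vec2 0 (c / a)) = c"
      using ab by auto
    thus ?thesis by (metis vec2_carrier)
  qed
  hence surj: "wedge v ` carrier_vec 2 = UNIV" by (auto simp: image_iff) metis
  have "mat_image (rank_one v w) = (\<lambda>x. wedge v x \<cdot>\<^sub>v w) ` carrier_vec 2"
    unfolding mat_image_def using assms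
    by (intro image_cong) (auto simp: rank_one_mult_vec)
  also have "\<dots> = (\<lambda>c. c \<cdot>\<^sub>v w) ` wedge v ` carrier_vec 2" by (simp add: image_image)
  finally show ?thesis by (simp add: surj line_through_def)
qed

lemma rank_one_in_ker_im_class:
  fixes v w :: "'a::field vec"
  assumes "v \<in> nonzero_vecs" "w \<in> nonzero_vecs"
  shows "rank_one v w \<in> ker_im_class (line_through v, line_through w)"
  using rank_one_nonzero[OF assms] mat_kernel_rank_one[OF assms] mat_image_rank_one[OF assms]
  by (simp add: ker_im_class_def det_rank_one)

lemma ker_im_classE:
  fixes A :: "'a::field mat"
  assumes "A \<in> ker_im_class (L, M)"
  obtains v w where "v \<in> nonzero_vecs" "w \<in> nonzero_vecs" "A = rank_one v w"
    "L = line_through v" "M = line_through w"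
proof -
  have A: "A \<in> carrier_mat 2 2" "A \<noteq> 0\<^sub>m 2 2" "det A = 0" "mat_kernel A = L" "mat_image A = M"
    using assms by (auto simp: ker_im_class_def)
  obtain v w where "v \<in> nonzero_vecs" "w \<in> nonzero_vecs" "A = rank_one v w"
    using A(1-3) by (rule singular_eq_rank_one)
  thus ?thesis using that A(4,5) by (simp add: mat_kernel_rank_one mat_image_rank_one)
qed

text \<open>Rescaling $v$ and $w$ rescales the rank one matrix, so all choices of generators of the two
  lines give matrices that differ by a nonzero scalar; it is kept on the side of $w$.\<close>

lemma ker_im_class_line_through:
  fixes v w :: "'a::field vec"
  assumes v: "v \<in> nonzero_vecs" and w: "w \<in> nonzero_vecs"
  shows "ker_im_class (line_through v, line_through w) =
    (\<lambda>c. rank_one v (c \<cdot>\<^sub>v w)) ` (UNIV - {0})"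
proof (intro subset_antisym subsetI)
  fix A assume A: "A \<in> ker_im_class (line_through v, line_through w)"
  then obtain v' w' where v': "v' \<in> nonzero_vecs" and w': "w' \<in> nonzero_vecs"
    and Aeq: "A = rank_one v' w'"
    and "line_through v = line_through v'" "line_through w = line_through w'"
    by (rule ker_im_classE)
  hence "v' \<in> line_through v" "w' \<in> line_through w" by (simp_all add: self_in_line_through)
  then obtain c d where c: "v' = c \<cdot>\<^sub>v v" and d: "w' = d \<cdot>\<^sub>v w"
    by (auto simp: line_through_def)
  have "c \<noteq> 0" "d \<noteq> 0" using c d v w v' w' by auto
  moreover have "A = rank_one v ((c * d) \<cdot>\<^sub>v w)"
    using v w by (auto simp: Aeq c d rank_one_def elim!: vec2_cases)
  ultimately show "A \<in> (\<lambda>c. rank_one v (c \<cdot>\<^sub>v w)) ` (UNIV - {0})" by auto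
next
  fix A assume "A \<in> (\<lambda>c. rank_one v (c \<cdot>\<^sub>v w)) ` (UNIV - {0})"
  then obtain c where c: "c \<noteq> 0" and A: "A = rank_one v (c \<cdot>\<^sub>v w)" by auto
  have cw: "c \<cdot>\<^sub>v w \<in> nonzero_vecs" using c w by (auto simp: zero_vec2 elim!: vec2_cases)
  have "line_through (c \<cdot>\<^sub>v w) = line_through w"
    by (rule line_through_cong[OF w cw]) (auto simp: line_through_def)
  thus "A \<in> ker_im_class (line_through v, line_through w)"
    using rank_one_in_ker_im_class[OF v cw] A by simp
qed

lemma card_ker_im_class:
  fixes \<alpha> :: "'a::{field,finite} vec set \<times> 'a vec set"
  assumes "\<alpha> \<in> line_pairs"
  shows "card (ker_im_class \<alpha>) = CARD('a) - 1"
proof -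
  from assms obtain v w where v: "v \<in> nonzero_vecs" and w: "w \<in> nonzero_vecs"
    and \<alpha>: "\<alpha> = (line_through v, line_through w)"
    by (auto simp: line_pairs_def elim!: line_obtain)
  have "inj_on (\<lambda>c. rank_one v (c \<cdot>\<^sub>v w)) (UNIV - {0})"
    using v w by (auto simp: inj_on_def rank_one_def zero_vec2 elim!: vec2_cases)
  thus ?thesis
    by (simp add: \<alpha> ker_im_class_line_through[OF v w] card_image card_Diff_singleton)
qed

lemma singular_iff_ker_im_class:
  fixes A :: "'a::{field,finite} mat"
  assumes "A \<in> carrier_mat 2 2"
  shows "A \<noteq> 0\<^sub>m 2 2 \<and> det A = 0 \<longleftrightarrow> (\<exists>\<alpha> \<in> line_pairs. A \<in> ker_im_class \<alpha>)"
proof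
  assume "A \<noteq> 0\<^sub>m 2 2 \<and> det A = 0"
  hence "A \<noteq> 0\<^sub>m 2 2" "det A = 0" by auto
  then obtain v w where v: "v \<in> nonzero_vecs" and w: "w \<in> nonzero_vecs"
    and A: "A = rank_one v w"
    by (rule singular_eq_rank_one[OF assms])
  have "A \<in> ker_im_class (line_through v, line_through w)"
    using A rank_one_in_ker_im_class[OF v w] by simp
  thus "\<exists>\<alpha> \<in> line_pairs. A \<in> ker_im_class \<alpha>"
    using v w by (auto simp: line_pairs_def lines_eq_line_through)
qed (auto simp: ker_im_class_def)

text \<open>The product of $x \mapsto (v \wedge x)\,w$ and $x \mapsto (v' \wedge x)\,w'$ is
  $x \mapsto (v' \wedge x)(v \wedge w')\,w$, which vanishes iff $w'$ lies on the line through $v$.\<close>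

lemma ker_im_class_mult_eq_0_iff:
  fixes A B :: "'a::field mat"
  assumes A: "A \<in> ker_im_class (L, M)" and B: "B \<in> ker_im_class (L', M')"
  shows "A * B = 0\<^sub>m 2 2 \<longleftrightarrow> M' = L"
proof -
  obtain v w where v: "v \<in> nonzero_vecs" and w: "w \<in> nonzero_vecs"
    and Aeq: "A = rank_one v w" and L: "L = line_through v"
    using A by (rule ker_im_classE)
  obtain v' w' where v': "v' \<in> nonzero_vecs" and w': "w' \<in> nonzero_vecs"
    and Beq: "B = rank_one v' w'" and M': "M' = line_through w'"
    using B by (rule ker_im_classE)
  have "A * B = rank_one v' (wedge v w' \<cdot>\<^sub>v w)"
    using v w v' w' by (auto simp: Aeq Beq rank_one_def algebra_simps elim!: vec2_cases)
  have "M' = L \<longleftrightarrow> wedge v w' = 0"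
    using line_through_eq_iff[OF v w'] unfolding L M' by metis
  also have "\<dots> \<longleftrightarrow> wedge v w' \<cdot>\<^sub>v w = 0\<^sub>v 2"
    using w by (auto simp: zero_vec2 elim!: vec2_cases)
  also have "\<dots> \<longleftrightarrow> rank_one v' (wedge v w' \<cdot>\<^sub>v w) = 0\<^sub>m 2 2"
    using v' w by (auto simp: rank_one_def zero_mat2 zero_vec2 elim!: vec2_cases)
  finally show ?thesis using \<open>A * B = _\<close> by simp
qed


section \<open>Block matrices and reordering\<close>

lemma indexed_mat_carrier: "indexed_mat xs f \<in> carrier_mat (length xs) (length xs)"
  by (simp add: indexed_mat_def)

lemma mult_permutation_mat:
  fixes B :: "'a::semiring_1 mat"
  assumes \<pi>: "\<pi> permutes {..<n}" and B: "B \<in> carrier_mat n n"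
  defines "P \<equiv> mat n n (\<lambda>(i, j). if j = \<pi> i then 1 else 0) :: 'a mat"
  shows "P * B = mat n n (\<lambda>(i, j). B $$ (\<pi> i, j))"
    and "B * P\<^sup>T = mat n n (\<lambda>(i, j). B $$ (i, \<pi> j))"
proof -
  have "\<pi> i < n" if "i < n" for i
    using \<pi> that by (metis lessThan_iff permutes_in_image)
  thus "P * B = mat n n (\<lambda>(i, j). B $$ (\<pi> i, j))"
    "B * P\<^sup>T = mat n n (\<lambda>(i, j). B $$ (i, \<pi> j))"
    using B by (auto intro!: eq_matI simp: P_def scalar_prod_def if_distrib[of "\<lambda>x. x * _"]
        if_distrib[of "\<lambda>x. _ * x"] cong: if_cong)
qed

lemma permutation_similar_reindex:
  fixes A B :: "'a::semiring_1 mat"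
  assumes \<pi>: "\<pi> permutes {..<n}" and A: "A \<in> carrier_mat n n" and B: "B \<in> carrier_mat n n"
    and AB: "\<And>i j. i < n \<Longrightarrow> j < n \<Longrightarrow> A $$ (i, j) = B $$ (\<pi> i, \<pi> j)"
  shows "permutation_similar A B"
proof -
  define P :: "'a mat" where "P = mat n n (\<lambda>(i, j). if j = \<pi> i then 1 else 0)"
  note mult = mult_permutation_mat[OF \<pi>, where 'a = 'a, folded P_def]
  have bound: "\<pi> i < n" if "i < n" for i
    using \<pi> that by (metis lessThan_iff permutes_in_image)
  have inj: "\<pi> i = \<pi> j \<longleftrightarrow> i = j" for i j using permutes_inj[OF \<pi>] by (auto dest: injD)
  have P: "P \<in> carrier_mat n n" "P\<^sup>T \<in> carrier_mat n n" by (simp_all add: P_def)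
  have "P * P\<^sup>T = 1\<^sub>m n"
    by (subst mult(1)[OF P(2)]) (auto intro!: eq_matI simp: P_def bound inj)
  moreover have "P\<^sup>T * P = 1\<^sub>m n"
  proof (intro eq_matI)
    fix i j assume "i < dim_row (1\<^sub>m n :: 'a mat)" "j < dim_col (1\<^sub>m n :: 'a mat)"
    hence ij: "i < n" "j < n" by simp_all
    have "(P\<^sup>T * P) $$ (i, j) = (\<Sum>k\<in>{0..<n}. (if i = \<pi> k then 1 else 0) * (if j = \<pi> k then 1 else 0))"
      using ij by (simp add: P_def scalar_prod_def)
    \<comment> \<open>The index $k$ is replaced by its image under the permutation.\<close>
    also have "\<dots> = (\<Sum>k\<in>{..<n}. (if i = k then 1 else 0) * (if j = k then 1 else 0))"
      using sum.permute[OF \<pi>, of "\<lambda>k. (if i = k then 1 else 0) * (if j = k then 1 else 0) :: 'a"]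
      by (simp add: comp_def lessThan_atLeast0)
    also have "\<dots> = 1\<^sub>m n $$ (i, j)"
      using ij by (auto simp: if_distrib[of "\<lambda>x. x * _"] cong: if_cong)
    finally show "(P\<^sup>T * P) $$ (i, j) = 1\<^sub>m n $$ (i, j)" .
  qed (simp_all add: P_def)
  moreover have "A = P * B * P\<^sup>T"
    unfolding mult(1)[OF B] by (subst mult(2)) (use A AB bound in \<open>auto intro!: eq_matI\<close>)
  ultimately have "similar_mat_wit A B P P\<^sup>T"
    using A B P by (auto simp: similar_mat_wit_def Let_def)
  moreover have "permutation_matrix (dim_row A) P"
    using A \<pi> by (auto simp: permutation_matrix_def P_def)
  ultimately show ?thesis unfolding permutation_similar_def by blast
qed

text \<open>A matrix indexed by a finite set is independent of the enumeration up to simultaneous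
  permutation of rows and columns.\<close>

lemma permutation_similar_indexed_mat:
  fixes f :: "'b \<Rightarrow> 'b \<Rightarrow> 'a::semiring_1"
  assumes "enumerates xs S" "enumerates ys S"
  shows "permutation_similar (indexed_mat xs f) (indexed_mat ys f)"
proof -
  have "mset xs = mset ys"
    using assms by (auto simp: enumerates_def set_eq_iff_mset_eq_distinct)
  then obtain \<pi> where \<pi>: "\<pi> permutes {..<length ys}" and xs: "permute_list \<pi> ys = xs"
    by (rule mset_eq_permutation)
  have len: "length xs = length ys" using xs by auto
  show ?thesis
  proof (rule permutation_similar_reindex[OF \<pi>])
    fix i j assume ij: "i < length ys" "j < length ys"
    have "\<pi> i < length ys" "\<pi> j < length ys"
      using \<pi> ij by (metis lessThan_iff permutes_in_image)+
    thus "indexed_mat xs f $$ (i, j) = indexed_mat ys f $$ (\<pi> i, \<pi> j)"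
      using ij len \<pi> by (simp add: indexed_mat_def xs[symmetric] permute_list_nth)
  qed (simp_all add: indexed_mat_def len)
qed

lemma length_concat_blocks:
  assumes "\<And>t. t \<in> set ts \<Longrightarrow> length (cs t) = m"
  shows "length (concat (map cs ts)) = length ts * m"
  using assms by (induction ts) auto

lemma nth_concat_blocks:
  assumes "\<And>t. t \<in> set ts \<Longrightarrow> length (cs t) = m" "a < length ts" "r < m"
  shows "concat (map cs ts) ! (a * m + r) = cs (ts ! a) ! r"
  using assms
proof (induction ts arbitrary: a)
  case (Cons t ts)
  show ?case
  proof (cases a)
    case 0
    thus ?thesis using Cons.prems by (simp add: nth_append)
  next
    case (Suc b)
    thus ?thesis using Cons.prems Cons.IH[of b] by (simp add: nth_append)
  qed
qed simp

lemma enumerates_concat: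
  assumes ts: "enumerates ts T" and cs: "\<And>t. t \<in> T \<Longrightarrow> enumerates (cs t) (C t)"
    and disj: "\<And>s t. s \<in> T \<Longrightarrow> t \<in> T \<Longrightarrow> s \<noteq> t \<Longrightarrow> C s \<inter> C t = {}"
  shows "enumerates (concat (map cs ts)) (\<Union>t \<in> T. C t)"
proof -
  have "distinct (concat (map cs ts'))" if "distinct ts'" "set ts' \<subseteq> T" for ts'
    using that
  proof (induction ts')
    case (Cons t ts')
    have "set (cs t) \<inter> (\<Union>s \<in> set ts'. set (cs s)) = {}"
    proof -
      have "set (cs t) \<inter> set (cs s) = {}" if "s \<in> set ts'" for s
        using disj[of t s] cs[of s] cs[of t] Cons.prems that
        by (auto simp: enumerates_def)
      thus ?thesis by blast
    qed
    thus ?case using Cons cs[of t] by (auto simp: enumerates_def)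
  qed simp
  thus ?thesis using ts cs by (auto simp: enumerates_def)
qed

text \<open>Submatrices address the \<open>r\<close>-th element of an index set through \<open>pick\<close>; for the index interval of
  a block this is an offset.\<close>

lemma pick_interval:
  assumes "r < m"
  shows "pick {a * m..<Suc a * m} r = a * m + r"
proof -
  have "{x \<in> {a * m..<Suc a * m}. x < a * m + r} = {a * m..<a * m + r}"
    using assms by auto
  thus ?thesis
    using pick_card_in_set[of "a * m + r" "{a * m..<Suc a * m}"] assms by simp
qed

lemma mat_block_eq:
  assumes A: "A \<in> carrier_mat (k * m) (k * m)" and a: "a < k" and b: "b < k"
  shows "mat_block m A a b = mat m m (\<lambda>(r, s). A $$ (a * m + r, b * m + s))"
proof -
  have "{i. i < k * m \<and> i \<in> {c * m..<(c + 1) * m}} = {c * m..<(c + 1) * m}" if "c < k" for c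
  proof -
    have "(c + 1) * m \<le> k * m" using that by (intro mult_le_mono1) simp
    thus ?thesis by auto
  qed
  hence "card {i. i < k * m \<and> i \<in> {c * m..<(c + 1) * m}} = m" if "c < k" for c
    using that by simp
  from this[OF a] this[OF b] A show ?thesis
    unfolding mat_block_def submatrix_def
    by (intro eq_matI) (auto simp: pick_interval simp del: atLeastLessThan_iff mult_Suc)
qed


section \<open>Zero divisors among the quaternions\<close>

lemma quat_mat_iso:
  fixes \<phi> :: "'p::prime_card lipschitz \<Rightarrow> 'p mod_ring mat"
  assumes "\<phi> \<in> quat_mat_isos"
  shows quat_mat_iso_bij: "bij_betw \<phi> UNIV (carrier_mat 2 2)"
    and quat_mat_iso_mult: "\<phi> (x * y) = \<phi> x * \<phi> y"
    and quat_mat_iso_eq_0_iff: "\<phi> x = 0\<^sub>m 2 2 \<longleftrightarrow> x = 0"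
    and quat_mat_iso_carrier: "\<phi> x \<in> carrier_mat 2 2"
proof -
  have hom: "\<phi> \<in> Ring.ring_hom class_ring (ring_mat TYPE('p mod_ring) 2 ())"
    and bij: "bij_betw \<phi> UNIV (carrier_mat 2 2)"
    using assms by (auto simp: ring_iso_def ring_mat_simps)
  show "bij_betw \<phi> UNIV (carrier_mat 2 2)" by fact
  show carrier: "\<phi> x \<in> carrier_mat 2 2" for x
    using bij by (auto simp: bij_betw_def)
  show "\<phi> (x * y) = \<phi> x * \<phi> y"
    using ring_hom_mult[OF hom, of x y] by (simp add: ring_mat_simps)
  \<comment> \<open>A ring homomorphism here preserves sums, products and one; that it maps zero to zero follows
    by cancellation.\<close>
  have "\<phi> 0 = \<phi> 0 + \<phi> 0"
    using ring_hom_add[OF hom, of 0 0] by (simp add: ring_mat_simps)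
  moreover obtain a b c d where abcd: "\<phi> 0 = mat2 a b c d" using carrier by (rule mat2_cases)
  ultimately have "\<phi> 0 = 0\<^sub>m 2 2" by (simp only: add_mat2 zero_mat2 mat2_eq_iff add_cancel_left_right add_cancel_right_right)
  thus "\<phi> x = 0\<^sub>m 2 2 \<longleftrightarrow> x = 0"
    using bij by (metis UNIV_I bij_betw_inv_into_left)
qed

lemma annihilated_imp_det_eq_0:
  fixes A B :: "'a::field mat"
  assumes A: "A \<in> carrier_mat n n" and B: "B \<in> carrier_mat n n" "B \<noteq> 0\<^sub>m n n"
    and zero: "A * B = 0\<^sub>m n n \<or> B * A = 0\<^sub>m n n"
  shows "det A = 0"
proof (rule ccontr)
  assume "det A \<noteq> 0"
  then obtain C where C: "C \<in> carrier_mat n n" "C * A = 1\<^sub>m n" "A * C = 1\<^sub>m n"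
    using det_non_zero_imp_unit[OF A, of "()"] by (auto simp: Units_def ring_mat_simps)
  have "B = C * (A * B)" using assoc_mult_mat[OF C(1) A B(1)] C B by simp
  moreover have "B = (B * A) * C" using assoc_mult_mat[OF B(1) A C(1)] C B by simp
  ultimately show False using zero B C by auto
qed

text \<open>The witness is the adjugate, as $A \operatorname{adj}(A) = \det(A)\,\mathbf{I} = 0$; in size two
  it is nonzero along with $A$.\<close>

lemma singular_mat2_imp_annihilated:
  fixes A :: "'a::field mat"
  assumes "A \<in> carrier_mat 2 2" "A \<noteq> 0\<^sub>m 2 2" "det A = 0"
  obtains B where "B \<in> carrier_mat 2 2" "B \<noteq> 0\<^sub>m 2 2" "A * B = 0\<^sub>m 2 2"
proof -
  obtain a b c d where A: "A = mat2 a b c d" using assms(1) by (rule mat2_cases)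
  show ?thesis
    using assms by (intro that[of "mat2 d (- b) (- c) a"]) (auto simp: A zero_mat2 algebra_simps)
qed

context
  fixes \<phi> :: "'p::prime_card lipschitz \<Rightarrow> 'p mod_ring mat"
  assumes \<phi>: "\<phi> \<in> quat_mat_isos"
begin

lemma zero_divisor_iff_singular:
  "x \<in> zero_divisors \<longleftrightarrow> \<phi> x \<noteq> 0\<^sub>m 2 2 \<and> det (\<phi> x) = 0"
proof
  assume "x \<in> zero_divisors"
  then obtain y where y: "y \<noteq> 0" "x * y = 0 \<or> y * x = 0" and x: "x \<noteq> 0"
    by (auto simp: zero_divisors_def)
  have "\<phi> x * \<phi> y = 0\<^sub>m 2 2 \<or> \<phi> y * \<phi> x = 0\<^sub>m 2 2"
    using y(2) by (simp add: quat_mat_iso_eq_0_iff[OF \<phi>] flip: quat_mat_iso_mult[OF \<phi>])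
  moreover have "\<phi> y \<noteq> 0\<^sub>m 2 2" using y(1) by (simp add: quat_mat_iso_eq_0_iff[OF \<phi>])
  ultimately have "det (\<phi> x) = 0"
    by (intro annihilated_imp_det_eq_0[of _ 2 "\<phi> y"] quat_mat_iso_carrier[OF \<phi>])
  thus "\<phi> x \<noteq> 0\<^sub>m 2 2 \<and> det (\<phi> x) = 0" using x by (simp add: quat_mat_iso_eq_0_iff[OF \<phi>])
next
  assume "\<phi> x \<noteq> 0\<^sub>m 2 2 \<and> det (\<phi> x) = 0"
  hence x: "\<phi> x \<noteq> 0\<^sub>m 2 2" "det (\<phi> x) = 0" by auto
  obtain B where B: "B \<in> carrier_mat 2 2" "B \<noteq> 0\<^sub>m 2 2" "\<phi> x * B = 0\<^sub>m 2 2"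
    by (rule singular_mat2_imp_annihilated[OF quat_mat_iso_carrier[OF \<phi>] x])
  from B(1) obtain y where y: "B = \<phi> y"
    using quat_mat_iso_bij[OF \<phi>] by (auto simp: bij_betw_def)
  have "y \<noteq> 0" "x * y = 0" "x \<noteq> 0"
    using x B by (simp_all add: y quat_mat_iso_eq_0_iff[OF \<phi>] flip: quat_mat_iso_mult[OF \<phi>])
  thus "x \<in> zero_divisors" by (auto simp: zero_divisors_def)
qed

lemma zero_divisors_eq_UN_classes:
  "zero_divisors = (\<Union>\<alpha> \<in> line_pairs. {x. \<phi> x \<in> ker_im_class \<alpha>})"
  using singular_iff_ker_im_class[OF quat_mat_iso_carrier[OF \<phi>]]
  by (auto simp: zero_divisor_iff_singular)

lemma card_class:
  assumes "\<alpha> \<in> line_pairs"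
  shows "card {x. \<phi> x \<in> ker_im_class \<alpha>} = CARD('p) - 1"
proof -
  have "card (\<phi> -` ker_im_class \<alpha>) = card (ker_im_class \<alpha>)"
  proof (rule card_vimage_inj)
    show "inj \<phi>" using quat_mat_iso_bij[OF \<phi>] by (simp add: bij_betw_def)
    have "ker_im_class \<alpha> \<subseteq> carrier_mat 2 2" by (cases \<alpha>) (auto simp: ker_im_class_def)
    thus "ker_im_class \<alpha> \<subseteq> range \<phi>" using quat_mat_iso_bij[OF \<phi>] by (simp add: bij_betw_def)
  qed
  thus ?thesis using card_ker_im_class[OF assms] by (simp add: vimage_def)
qed

lemma edge_iff:
  assumes \<alpha>: "(L, M) \<in> line_pairs" and \<beta>: "(L', M') \<in> line_pairs"
    and x: "\<phi> x \<in> ker_im_class (L, M)" and y: "\<phi> y \<in> ker_im_class (L', M')"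
  shows "{x, y} \<in> snd lipschitz_graph \<longleftrightarrow> x \<noteq> y \<and> (M = L' \<or> M' = L)"
proof -
  have "x * y = 0 \<longleftrightarrow> M' = L"
    using ker_im_class_mult_eq_0_iff[OF x y]
    by (simp add: quat_mat_iso_eq_0_iff[OF \<phi>] flip: quat_mat_iso_mult[OF \<phi>])
  moreover have "y * x = 0 \<longleftrightarrow> M = L'"
    using ker_im_class_mult_eq_0_iff[OF y x]
    by (simp add: quat_mat_iso_eq_0_iff[OF \<phi>] flip: quat_mat_iso_mult[OF \<phi>])
  moreover have "x \<in> zero_divisors" "y \<in> zero_divisors"
    unfolding zero_divisors_eq_UN_classes using assms by auto
  ultimately show ?thesis
    by (auto simp: lipschitz_graph_def zero_divisor_graph_def doubleton_eq_iff)
qed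

section \<open>The adjacency matrix in the class ordering\<close>

context
  fixes ts :: "('p mod_ring vec set \<times> 'p mod_ring vec set) list"
    and cs :: "'p mod_ring vec set \<times> 'p mod_ring vec set \<Rightarrow> 'p lipschitz list"
  assumes ts: "enumerates ts line_pairs"
    and cs: "\<And>\<alpha>. \<alpha> \<in> line_pairs \<Longrightarrow> enumerates (cs \<alpha>) {x. \<phi> x \<in> ker_im_class \<alpha>}"
begin

lemma class_ordering_enumerates:
  "enumerates (concat (map cs ts)) (fst lipschitz_graph)"
proof -
  have "enumerates (concat (map cs ts)) (\<Union>\<alpha> \<in> line_pairs. {x. \<phi> x \<in> ker_im_class \<alpha>})"
    by (rule enumerates_concat[OF ts cs]) (auto simp: ker_im_class_def)
  thus ?thesis
    by (simp add: lipschitz_graph_def zero_divisor_graph_def zero_divisors_eq_UN_classes)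
qed

lemma length_class:
  assumes "\<alpha> \<in> set ts"
  shows "length (cs \<alpha>) = CARD('p) - 1"
proof -
  have "\<alpha> \<in> line_pairs" using assms ts by (simp add: enumerates_def)
  thus ?thesis using cs card_class by (metis distinct_card enumerates_def)
qed

lemma adjacency_matrix_carrier:
  "adjacency_matrix lipschitz_graph (concat (map cs ts)) \<in>
     carrier_mat (length ts * (CARD('p) - 1)) (length ts * (CARD('p) - 1))"
  using length_concat_blocks[of ts cs, OF length_class]
    indexed_mat_carrier[of "concat (map cs ts)"]
  unfolding adjacency_matrix_def by simp

text \<open>Position $r$ in the block of the class \<open>ts ! a\<close> and position $s$ in the block of \<open>ts ! b\<close> carry the
  same vertex only if $a = b$ and $r = s$. In a diagonal block $H$ and $D$ both have the entry 1 if
  $L = M$ and 0 otherwise, so the difference removes precisely the loops.\<close>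

lemma adjacency_matrix_entry:
  defines "m \<equiv> CARD('p) - 1"
  assumes a: "a < length ts" and b: "b < length ts" and r: "r < m" and s: "s < m"
  shows "adjacency_matrix lipschitz_graph (concat (map cs ts)) $$ (a * m + r, b * m + s) =
    H_mat ts $$ (a, b) - (if r = s then D_mat ts $$ (a, b) else 0)"
proof -
  obtain L M where \<alpha>: "ts ! a = (L, M)" by fastforce
  obtain L' M' where \<beta>: "ts ! b = (L', M')" by fastforce
  have \<alpha>\<beta>: "(L, M) \<in> line_pairs" "(L', M') \<in> line_pairs"
    using nth_mem[OF a] nth_mem[OF b] ts by (auto simp: \<alpha> \<beta> enumerates_def)
  have len: "length (cs \<alpha>) = m" if "\<alpha> \<in> set ts" for \<alpha>
    using length_class[OF that] by (simp add: m_def)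
  define x y where "x = cs (L, M) ! r" and "y = cs (L', M') ! s"
  have "length (cs (L, M)) = m" "length (cs (L', M')) = m"
    using len nth_mem[OF a] nth_mem[OF b] by (auto simp: \<alpha> \<beta>)
  note lens = this
  have x: "\<phi> x \<in> ker_im_class (L, M)" and y: "\<phi> y \<in> ker_im_class (L', M')"
    using cs[OF \<alpha>\<beta>(1)] cs[OF \<alpha>\<beta>(2)] nth_mem[of r "cs (L, M)"] nth_mem[of s "cs (L', M')"] r s lens
    by (auto simp: x_def y_def enumerates_def)
  have ab: "a = b \<longleftrightarrow> (L, M) = (L', M')"
    using ts a b by (metis \<alpha> \<beta> enumerates_def nth_eq_iff_index_eq)
  have "x = y \<longleftrightarrow> a = b \<and> r = s"
  proof
    assume "x = y"
    hence "(L, M) = (L', M')" using x y by (auto simp: ker_im_class_def)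
    moreover from this have "r = s"
      using \<open>x = y\<close> cs[OF \<alpha>\<beta>(1)] lens r s
      by (auto simp: x_def y_def enumerates_def nth_eq_iff_index_eq)
    ultimately show "a = b \<and> r = s" using ab by simp
  qed (use ab in \<open>auto simp: x_def y_def\<close>)
  moreover have "concat (map cs ts) ! (a * m + r) = x" "concat (map cs ts) ! (b * m + s) = y"
    using nth_concat_blocks[of ts cs m, OF len a r] nth_concat_blocks[of ts cs m, OF len b s]
    by (simp_all add: x_def y_def \<alpha> \<beta>)
  moreover have "c * m + t < length (concat (map cs ts))" if "c < length ts" "t < m" for c t
  proof -
    have "c * m + t < (c + 1) * m" using that by simp
    also have "\<dots> \<le> length ts * m" using that by (intro mult_le_mono1) simp
    finally show ?thesis using length_concat_blocks[of ts cs m, OF len] by simp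
  qed
  ultimately have "adjacency_matrix lipschitz_graph (concat (map cs ts)) $$ (a * m + r, b * m + s) =
      (if \<not> (a = b \<and> r = s) \<and> (M = L' \<or> M' = L) then 1 else 0)"
    using edge_iff[OF \<alpha>\<beta> x y] a b r s by (simp add: adjacency_matrix_def indexed_mat_def)
  also have "\<dots> = H_mat ts $$ (a, b) - (if r = s then D_mat ts $$ (a, b) else 0)"
    using a b ab by (auto simp: H_mat_def D_mat_def indexed_mat_def \<alpha> \<beta>)
  finally show ?thesis .
qed

lemma adjacency_matrix_eq_kronecker:
  "adjacency_matrix lipschitz_graph (concat (map cs ts)) =
   kronecker (H_mat ts) (ones_mat (CARD('p) - 1)) - kronecker (D_mat ts) (1\<^sub>m (CARD('p) - 1))"
    (is "?A = ?K")
proof (rule eq_matI)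
  let ?m = "CARD('p) - 1"
  have HD: "dim_row (H_mat ts) = length ts" "dim_col (H_mat ts) = length ts"
    "dim_row (D_mat ts) = length ts" "dim_col (D_mat ts) = length ts"
    by (simp_all add: H_mat_def D_mat_def indexed_mat_def)
  have K: "dim_row ?K = length ts * ?m" "dim_col ?K = length ts * ?m"
    by (simp_all add: kronecker_def HD)
  show "dim_row ?A = dim_row ?K" "dim_col ?A = dim_col ?K"
    unfolding K using adjacency_matrix_carrier by auto
  fix i j assume "i < dim_row ?K" "j < dim_col ?K"
  hence ij: "i < length ts * ?m" "j < length ts * ?m" unfolding K by auto
  hence "?m > 0" by (cases "?m = 0") auto
  hence mod: "i mod ?m < ?m" "j mod ?m < ?m" by simp_all
  have div: "i div ?m < length ts" "j div ?m < length ts"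
    using ij by (simp_all add: less_mult_imp_div_less)
  have "?A $$ (i, j) = ?A $$ (i div ?m * ?m + i mod ?m, j div ?m * ?m + j mod ?m)"
    by (simp only: div_mult_mod_eq)
  also have "\<dots> = H_mat ts $$ (i div ?m, j div ?m) -
      (if i mod ?m = j mod ?m then D_mat ts $$ (i div ?m, j div ?m) else 0)"
    by (rule adjacency_matrix_entry[OF div mod])
  also have "\<dots> = ?K $$ (i, j)"
    using ij mod by (simp add: kronecker_def HD ones_mat_def)
  finally show "?A $$ (i, j) = ?K $$ (i, j)" .
qed

text \<open>By the formula for the entries, a block is constant with value $h$ except for its diagonal,
  which is lowered by $d$; the three cases are the possible values of $(h, d)$.\<close>

lemma adjacency_matrix_block:
  defines "m \<equiv> CARD('p) - 1"
  assumes a: "a < length ts" and b: "b < length ts"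
    and \<alpha>: "ts ! a = (L, M)" and \<beta>: "ts ! b = (L', M')"
  shows "mat_block m (adjacency_matrix lipschitz_graph (concat (map cs ts))) a b =
    (if (L, M) = (L', M') \<and> L = M then ones_mat m - 1\<^sub>m m
     else if (L, M) \<noteq> (L', M') \<and> (M = L' \<or> M' = L) then ones_mat m
     else 0\<^sub>m m m)"
proof -
  define h d where "h = H_mat ts $$ (a, b)" and "d = D_mat ts $$ (a, b)"
  have block: "mat_block m (adjacency_matrix lipschitz_graph (concat (map cs ts))) a b =
    mat m m (\<lambda>(r, s). h - (if r = s then d else 0))"
  proof (rule eq_matI)
    fix r s
    assume "r < dim_row (mat m m (\<lambda>(r, s). h - (if r = s then d else 0)))"
      and "s < dim_col (mat m m (\<lambda>(r, s). h - (if r = s then d else 0)))"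
    hence "r < m" "s < m" by simp_all
    thus "mat_block m (adjacency_matrix lipschitz_graph (concat (map cs ts))) a b $$ (r, s) =
        mat m m (\<lambda>(r, s). h - (if r = s then d else 0)) $$ (r, s)"
      unfolding mat_block_eq[OF adjacency_matrix_carrier[folded m_def] a b]
      by (simp add: adjacency_matrix_entry[OF a b, folded m_def] h_def d_def)
  qed (simp_all add: mat_block_eq[OF adjacency_matrix_carrier[folded m_def] a b])
  have H: "h = (if M = L' \<or> M' = L then 1 else 0)"
    and D: "d = (if (L, M) = (L', M') \<and> L = M then 1 else 0)"
    using a b by (simp_all add: h_def d_def H_mat_def D_mat_def indexed_mat_def \<alpha> \<beta>)
  consider (loop) "(L, M) = (L', M') \<and> L = M"
    | (edge) "\<not> ((L, M) = (L', M') \<and> L = M)" "(L, M) \<noteq> (L', M') \<and> (M = L' \<or> M' = L)"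
    | (none) "\<not> ((L, M) = (L', M') \<and> L = M)" "\<not> ((L, M) \<noteq> (L', M') \<and> (M = L' \<or> M' = L))"
    by argo
  thus ?thesis
  proof cases
    case loop
    hence "h = 1" "d = 1" unfolding H D by auto
    thus ?thesis unfolding block if_P[OF loop]
      by (intro eq_matI) (simp_all add: ones_mat_def)
  next
    case edge
    hence "h = 1" "d = 0" unfolding H D by auto
    thus ?thesis unfolding block if_not_P[OF edge(1)] if_P[OF edge(2)]
      by (intro eq_matI) (simp_all add: ones_mat_def)
  next
    case none
    hence "h = 0" "d = 0" unfolding H D by auto
    thus ?thesis unfolding block if_not_P[OF none(1)] if_not_P[OF none(2)]
      by (intro eq_matI) simp_all
  qed
qed

end

end

theorem theorem3p3:
  fixes p :: nat
    and ts :: "('p::prime_card mod_ring vec set \<times> 'p mod_ring vec set) list"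
  assumes p: "p = CARD('p)" "odd p"
    and ts: "enumerates ts line_pairs"
  shows
    "H_mat ts \<in> carrier_mat ((p + 1)\<^sup>2) ((p + 1)\<^sup>2) \<and>
     D_mat ts \<in> carrier_mat ((p + 1)\<^sup>2) ((p + 1)\<^sup>2) \<and>
     (\<forall>vs. enumerates vs (fst (lipschitz_graph :: 'p lipschitz sgraph)) \<longrightarrow>
        permutation_similar (adjacency_matrix lipschitz_graph vs)
          (kronecker (H_mat ts) (ones_mat (p - 1)) - kronecker (D_mat ts) (1\<^sub>m (p - 1)))) \<and>
     (\<forall>\<phi> \<in> quat_mat_isos. \<forall>cs vs.
        (\<forall>\<alpha> \<in> line_pairs. enumerates (cs \<alpha>) {x :: 'p lipschitz. \<phi> x \<in> ker_im_class \<alpha>}) \<and>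
        vs = concat (map cs ts) \<longrightarrow>
          enumerates vs (fst (lipschitz_graph :: 'p lipschitz sgraph)) \<and>
          (\<forall>a < length ts. \<forall>b < length ts. \<forall>L M L' M'.
             ts ! a = (L, M) \<and> ts ! b = (L', M') \<longrightarrow>
             mat_block (p - 1) (adjacency_matrix lipschitz_graph vs) a b =
               (if (L, M) = (L', M') \<and> L = M then ones_mat (p - 1) - 1\<^sub>m (p - 1)
                else if (L, M) \<noteq> (L', M') \<and> (M = L' \<or> M' = L) then ones_mat (p - 1)
                else 0\<^sub>m (p - 1) (p - 1))))"
proof (intro conjI allI ballI impI)
  have "length ts = card (line_pairs :: ('p mod_ring vec set \<times> 'p mod_ring vec set) set)"
    using ts by (auto simp: enumerates_def distinct_card[symmetric])
  hence len: "length ts = (p + 1)\<^sup>2"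
    by (simp add: line_pairs_def card_cartesian_product card_lines p power2_eq_square)
  show "H_mat ts \<in> carrier_mat ((p + 1)\<^sup>2) ((p + 1)\<^sup>2)"
    "D_mat ts \<in> carrier_mat ((p + 1)\<^sup>2) ((p + 1)\<^sup>2)"
    unfolding H_mat_def D_mat_def len[symmetric] by (rule indexed_mat_carrier)+
next
  fix vs assume vs: "enumerates vs (fst (lipschitz_graph :: 'p lipschitz sgraph))"
  obtain \<phi> :: "'p lipschitz \<Rightarrow> 'p mod_ring mat" where \<phi>: "\<phi> \<in> quat_mat_isos"
    using quat_mat_isos_nonempty p by blast
  \<comment> \<open>The isomorphism and the order within each class are arbitrary choices.\<close>
  define cs where "cs \<alpha> = (SOME xs. enumerates xs {x. \<phi> x \<in> ker_im_class \<alpha>})" for \<alpha>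
  have cs: "enumerates (cs \<alpha>) {x. \<phi> x \<in> ker_im_class \<alpha>}" if "\<alpha> \<in> line_pairs" for \<alpha>
  proof -
    have "CARD('p) > 1" by (rule nontriv)
    hence "finite {x. \<phi> x \<in> ker_im_class \<alpha>}"
      using card_class[OF \<phi> that] by (intro card_ge_0_finite) simp
    hence "\<exists>xs. enumerates xs {x. \<phi> x \<in> ker_im_class \<alpha>}"
      by (auto simp: enumerates_def dest: finite_distinct_list)
    thus ?thesis unfolding cs_def by (rule someI_ex)
  qed
  have "permutation_similar (adjacency_matrix lipschitz_graph vs)
      (adjacency_matrix lipschitz_graph (concat (map cs ts)))"
    unfolding adjacency_matrix_def
    by (rule permutation_similar_indexed_mat[OF vs class_ordering_enumerates[OF \<phi> ts cs]])
  thus "permutation_similar (adjacency_matrix lipschitz_graph vs)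
      (kronecker (H_mat ts) (ones_mat (p - 1)) - kronecker (D_mat ts) (1\<^sub>m (p - 1)))"
    by (simp only: adjacency_matrix_eq_kronecker[OF \<phi> ts cs] p)
next
  fix \<phi> :: "'p lipschitz \<Rightarrow> 'p mod_ring mat" and cs vs
  assume \<phi>: "\<phi> \<in> quat_mat_isos"
    and asm: "(\<forall>\<alpha> \<in> line_pairs. enumerates (cs \<alpha>) {x. \<phi> x \<in> ker_im_class \<alpha>}) \<and>
      vs = concat (map cs ts)"
  hence cs: "enumerates (cs \<alpha>) {x. \<phi> x \<in> ker_im_class \<alpha>}" if "\<alpha> \<in> line_pairs" for \<alpha>
    using that by blast
  have vs: "vs = concat (map cs ts)" using asm by blast
  show "enumerates vs (fst lipschitz_graph)"
    unfolding vs by (rule class_ordering_enumerates[OF \<phi> ts cs])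
  fix a b L M L' M'
  assume "a < length ts" "b < length ts" "ts ! a = (L, M) \<and> ts ! b = (L', M')"
  thus "mat_block (p - 1) (adjacency_matrix lipschitz_graph vs) a b =
      (if (L, M) = (L', M') \<and> L = M then ones_mat (p - 1) - 1\<^sub>m (p - 1)
       else if (L, M) \<noteq> (L', M') \<and> (M = L' \<or> M' = L) then ones_mat (p - 1)
       else 0\<^sub>m (p - 1) (p - 1))"
    unfolding vs p(1) by (intro adjacency_matrix_block[OF \<phi> ts cs]) blast+
qed

end
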